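(* There is a rational three-product instance of the cardinality-constrained randomized BMS problem with $K=2$ (i.e. $n=3$, rational $r_i,v_i>0$ for $i\in\{1,2,3\}$, and rational $\alpha\in(0,1]$) whose unique optimal active set is not a northeast rectangle in revenue and attractiveness. That is, there is a set $A\subseteq\{1,2,3\}$ such that every optimal feasible $w$ has $\operatorname{supp}(w)=A$, and there are no thresholds $\bar r,\bar v$ with $A=\{i:r_i\ge\bar r,\ v_i\ge\bar v\}$.
   Context: For data $r_i,v_i>0$ ($i\in N=\{1,\dots,n\}$), $\alpha\in(0,1]$, and an integer $K\in\{1,\dots,n\}$, the cardinality-constrained randomized BMS (balanced market share) problem is taken in its sales-space form: a vector $w\in\mathbb R_+^n$ is feasible if $0\le w_i\le v_i$ for all $i\in N$, $\sum_{i\in N}w_i/v_i\le K$, and for each $i\in N$ either $w_i=0$ or $w_i\ge\alpha\max_{j\in N}w_j$. The objective is to maximize the revenue $F(w)=\dfrac{\sum_i r_iw_i}{1+\sum_i w_i}$. The active set of $w$ is $\operatorname{supp}(w)=\{i\in N:w_i>0\}$. A northeast rectangle is a set of the form $\{i\in N:r_i\ge\bar r,\ v_i\ge\bar v\}$ for some real thresholds $\bar r,\bar v$. *)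

theory Defs
  imports Complex_Main
begin

text \<open>
  The products are \<open>{1..n}\<close>, and data and sales vectors are functions on \<open>nat\<close> of which only
  the values on \<open>{1..n}\<close> matter.
\<close>

definition bms_instance :: "nat \<Rightarrow> nat \<Rightarrow> (nat \<Rightarrow> real) \<Rightarrow> (nat \<Rightarrow> real) \<Rightarrow> real \<Rightarrow> bool" where
  "bms_instance n K r v \<alpha> \<longleftrightarrow>
     (\<forall>i\<in>{1..n}. 0 < r i \<and> 0 < v i) \<and> 0 < \<alpha> \<and> \<alpha> \<le> 1 \<and> K \<in> {1..n}"

definition bms_feasible ::
  "nat \<Rightarrow> nat \<Rightarrow> (nat \<Rightarrow> real) \<Rightarrow> real \<Rightarrow> (nat \<Rightarrow> real) \<Rightarrow> bool" where
  "bms_feasible n K v \<alpha> w \<longleftrightarrow>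
     (\<forall>i\<in>{1..n}. 0 \<le> w i \<and> w i \<le> v i) \<and>
     (\<Sum>i\<in>{1..n}. w i / v i) \<le> real K \<and>
     (\<forall>i\<in>{1..n}. w i = 0 \<or> w i \<ge> \<alpha> * (MAX j\<in>{1..n}. w j))"

definition bms_revenue :: "nat \<Rightarrow> (nat \<Rightarrow> real) \<Rightarrow> (nat \<Rightarrow> real) \<Rightarrow> real" where
  "bms_revenue n r w = (\<Sum>i\<in>{1..n}. r i * w i) / (1 + (\<Sum>i\<in>{1..n}. w i))"

definition bms_optimal ::
  "nat \<Rightarrow> nat \<Rightarrow> (nat \<Rightarrow> real) \<Rightarrow> (nat \<Rightarrow> real) \<Rightarrow> real \<Rightarrow> (nat \<Rightarrow> real) \<Rightarrow> bool" where
  "bms_optimal n K r v \<alpha> w \<longleftrightarrow>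
     bms_feasible n K v \<alpha> w \<and>
     (\<forall>w'. bms_feasible n K v \<alpha> w' \<longrightarrow> bms_revenue n r w' \<le> bms_revenue n r w)"

definition active_set :: "nat \<Rightarrow> (nat \<Rightarrow> real) \<Rightarrow> nat set" where
  "active_set n w = {i\<in>{1..n}. w i > 0}"

definition northeast_rectangle ::
  "nat \<Rightarrow> (nat \<Rightarrow> real) \<Rightarrow> (nat \<Rightarrow> real) \<Rightarrow> nat set \<Rightarrow> bool" where
  "northeast_rectangle n r v A \<longleftrightarrow>
     (\<exists>r_min v_min. A = {i\<in>{1..n}. r i \<ge> r_min \<and> v i \<ge> v_min})"

end

theory Submission
  imports Defs
begin

text \<open>
  With \<open>x\<^sub>i = w\<^sub>i / v\<^sub>i\<close>, comparing the revenue with a level \<open>\<lambda>\<close> amounts to the linear objective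
  \<open>\<Sum>\<^sub>i g\<^sub>i x\<^sub>i\<close>, \<open>g\<^sub>i = v\<^sub>i (r\<^sub>i - \<lambda>)\<close>, over \<open>0 \<le> x\<^sub>i \<le> 1\<close>, \<open>\<Sum>\<^sub>i x\<^sub>i \<le> K\<close>, compared with \<open>\<lambda>\<close>. The instance below is
  tuned to the optimal value \<open>\<lambda> = 1\<close>, with \<open>g = (1/2, 3/8, 1/2)\<close>: the middle product loses against
  a high-revenue and a high-attractiveness one, as the level sets of \<open>v (r - \<lambda>)\<close> are
  hyperbolas. The ratio bound \<open>\<alpha> = 1/4\<close> still admits the optimum \<open>w = (1, 0, 4)\<close>.
\<close>

definition ex_r :: "nat \<Rightarrow> real" where
  "ex_r i = (if i = 1 then 3/2 else if i = 2 then 19/16 else 9/8)"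

definition ex_v :: "nat \<Rightarrow> real" where
  "ex_v i = (if i = 1 then 1 else if i = 2 then 2 else 4)"

definition ex_w :: "nat \<Rightarrow> real" where
  "ex_w i = (if i = 1 then 1 else if i = 2 then 0 else 4)"

lemma atLeastAtMost_1_3: "{1..3::nat} = {1, 2, 3}"
  by auto

lemma ex_feasible: "bms_feasible 3 2 ex_v (1/4) ex_w"
  unfolding bms_feasible_def atLeastAtMost_1_3 by (simp add: ex_v_def ex_w_def)

lemma ex_revenue: "bms_revenue 3 ex_r ex_w = 1"
  unfolding bms_revenue_def atLeastAtMost_1_3 by (simp add: ex_r_def ex_w_def)

lemma ex_revenue_le_one_iff:
  assumes "w 1 \<ge> 0" "w 2 \<ge> 0" "w 3 \<ge> 0"
  shows "bms_revenue 3 ex_r w \<le> 1 \<longleftrightarrow> w 1 / 2 + 3 * w 2 / 16 + w 3 / 8 \<le> 1"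
    and "bms_revenue 3 ex_r w = 1 \<longleftrightarrow> w 1 / 2 + 3 * w 2 / 16 + w 3 / 8 = 1"
proof -
  have pos: "0 < 1 + (w 1 + (w 2 + w 3))"
    using assms by simp
  have rev: "bms_revenue 3 ex_r w =
      (3/2 * w 1 + (19/16 * w 2 + 9/8 * w 3)) / (1 + (w 1 + (w 2 + w 3)))"
    unfolding bms_revenue_def atLeastAtMost_1_3 by (simp add: ex_r_def)
  show "bms_revenue 3 ex_r w \<le> 1 \<longleftrightarrow> w 1 / 2 + 3 * w 2 / 16 + w 3 / 8 \<le> 1"
    unfolding rev pos_divide_le_eq[OF pos] by (auto simp: field_simps)
  show "bms_revenue 3 ex_r w = 1 \<longleftrightarrow> w 1 / 2 + 3 * w 2 / 16 + w 3 / 8 = 1"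
    unfolding rev nonzero_divide_eq_eq[OF less_imp_neq[OF pos, symmetric]] by (auto simp: field_simps)
qed

lemma ex_feasibleD:
  assumes "bms_feasible 3 2 ex_v \<alpha> w"
  shows "0 \<le> w 1" "w 1 \<le> 1" "0 \<le> w 2" "0 \<le> w 3" "w 3 \<le> 4"
    and "w 1 + w 2 / 2 + w 3 / 4 \<le> 2"
  using assms unfolding bms_feasible_def atLeastAtMost_1_3 by (auto simp: ex_v_def)

lemma ex_optimal: "bms_optimal 3 2 ex_r ex_v (1/4) ex_w"
  unfolding bms_optimal_def ex_revenue
proof (intro conjI allI impI ex_feasible)
  fix w
  assume "bms_feasible 3 2 ex_v (1/4) w"
  note w = ex_feasibleD[OF this]
  show "bms_revenue 3 ex_r w \<le> 1"
    \<comment> \<open>In the shares \<open>x i = w i / ex_v i\<close> the linear form is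
      \<open>x 1 / 2 + 3 * x 2 / 8 + x 3 / 2\<close>, at most half the share sum, which is at most
      2.\<close>
    using w ex_revenue_le_one_iff(1)[of w] by linarith
qed

lemma ex_active_set:
  assumes "bms_optimal 3 2 ex_r ex_v (1/4) w"
  shows "active_set 3 w = {1, 3}"
proof -
  have "bms_feasible 3 2 ex_v (1/4) w"
    using assms by (simp add: bms_optimal_def)
  note w = ex_feasibleD[OF this]
  have "bms_revenue 3 ex_r w = 1"
    using assms ex_optimal ex_revenue by (metis antisym bms_optimal_def)
  then have "w 1 / 2 + 3 * w 2 / 16 + w 3 / 8 = 1"
    using ex_revenue_le_one_iff(2)[of w] w by blast
  \<comment> \<open>Since 3/8 < 1/2, equality forces share 2 to vanish; the other two, each at most
    1, then sum to 2.\<close>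
  then have "w 1 > 0" "w 2 = 0" "w 3 > 0"
    using w by linarith+
  then show ?thesis
    unfolding active_set_def atLeastAtMost_1_3 by auto
qed

lemma ex_not_northeast: "\<not> northeast_rectangle 3 ex_r ex_v {1, 3}"
proof
  assume "northeast_rectangle 3 ex_r ex_v {1, 3}"
  then obtain a b where A: "{1, 3} = {i\<in>{1..3::nat}. ex_r i \<ge> a \<and> ex_v i \<ge> b}"
    unfolding northeast_rectangle_def by blast
  \<comment> \<open>Product 2 beats product 3 in revenue and product 1 in attractiveness, so it
    passes both thresholds.\<close>
  have "ex_r 3 \<ge> a" "ex_v 1 \<ge> b"
    using A by blast+
  then have "2 \<in> {i\<in>{1..3::nat}. ex_r i \<ge> a \<and> ex_v i \<ge> b}"
    by (simp add: ex_r_def ex_v_def)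
  then show False
    unfolding A[symmetric] by simp
qed

theorem proposition6:
  "\<exists>(r :: nat \<Rightarrow> real) (v :: nat \<Rightarrow> real) (\<alpha> :: real).
     bms_instance 3 2 r v \<alpha> \<and>
     (\<forall>i\<in>{1..3}. r i \<in> \<rat> \<and> v i \<in> \<rat>) \<and> \<alpha> \<in> \<rat> \<and>
     (\<exists>A \<subseteq> {1..3}.
        (\<exists>w. bms_optimal 3 2 r v \<alpha> w) \<and>
        (\<forall>w. bms_optimal 3 2 r v \<alpha> w \<longrightarrow> active_set 3 w = A) \<and>
        \<not> northeast_rectangle 3 r v A)"
proof (intro exI conjI)
  show "bms_instance 3 2 ex_r ex_v (1/4)"
    by (simp add: bms_instance_def ex_r_def ex_v_def)
  show "\<forall>i\<in>{1..3}. ex_r i \<in> \<rat> \<and> ex_v i \<in> \<rat>"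
    by (simp add: ex_r_def ex_v_def)
  show "(1/4 :: real) \<in> \<rat>"
    by simp
  show "{1, 3} \<subseteq> {1..3::nat}"
    by simp
  show "bms_optimal 3 2 ex_r ex_v (1/4) ex_w"
    by (rule ex_optimal)
  show "\<forall>w. bms_optimal 3 2 ex_r ex_v (1/4) w \<longrightarrow> active_set 3 w = {1, 3}"
    by (simp add: ex_active_set)
  show "\<not> northeast_rectangle 3 ex_r ex_v {1, 3}"
    by (rule ex_not_northeast)
qed

end
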